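(* Let $\mathbb{D}=\{z\in\mathbb{C} : |z|<1\}$ and $\lambda_{\mathbb{D}}(z)=\dfrac{2}{1-|z|^2}$. If $\lambda(z)\,|dz|$ is an SK-metric on $\mathbb{D}$, then $\lambda(z)\le\lambda_{\mathbb{D}}(z)$ for every $z\in\mathbb{D}$. In particular, $\lambda_{\mathbb{D}}(z)\,|dz|$ is the (unique) maximal SK-metric on $\mathbb{D}$.
   Context: A conformal pseudo-metric $\lambda(z)\,|dz|$ on an open set $G\subseteq\mathbb{C}$ is given by a continuous function $\lambda:G\to[0,+\infty)$, $\lambda\not\equiv 0$ (its density). For a continuous real-valued function $u$ near a point $z$, the generalized lower Laplace operator is $\Delta u(z)=\liminf_{r\to 0}\frac{4}{r^2}\left(\frac{1}{2\pi}\int_0^{2\pi}u(z+re^{it})\,dt-u(z)\right)$ (it agrees with the usual Laplacian if $u$ is $C^2$ near $z$). At a point $z\in G$ with $\lambda(z)>0$ the curvature of $\lambda(z)\,|dz|$ is $\kappa_\lambda(z)=-\Delta(\log\lambda)(z)/\lambda(z)^2$. The pseudo-metric $\lambda(z)\,|dz|$ is called an SK-metric on $G$ if $\kappa_\lambda(z)\le -1$ at every $z\in G$ with $\lambda(z)>0$. An SK-metric is maximal on $G$ if its density is pointwise greater than or equal to the density of every SK-metric on $G$. *)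

theory Defs
  imports "HOL-Analysis.Analysis"
begin

text \<open>A conformal pseudo-metric is identified with its density. Densities are total functions on
  \<^typ>\<open>complex\<close>; only their values on \<open>G\<close> matter.\<close>

definition conformal_pseudo_metric :: "complex set \<Rightarrow> (complex \<Rightarrow> real) \<Rightarrow> bool" where
  "conformal_pseudo_metric G lam \<longleftrightarrow>
     open G \<and> continuous_on G lam \<and> (\<forall>z\<in>G. 0 \<le> lam z) \<and> (\<exists>z\<in>G. lam z \<noteq> 0)"

text \<open>The lower limit is taken over radii \<open>r > 0\<close> and in the extended reals, since it may be
  infinite.\<close>

definition gen_lower_laplacian :: "(complex \<Rightarrow> real) \<Rightarrow> complex \<Rightarrow> ereal" where
  "gen_lower_laplacian u z =
     Liminf (at_right 0) (\<lambda>r::real. ereal (4 / r\<^sup>2 *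
       (1 / (2 * pi) * integral {0..2 * pi} (\<lambda>t. u (z + complex_of_real r * exp (\<i> * complex_of_real t)))
        - u z)))"

text \<open>Only meaningful at points \<open>z\<close> of \<open>G\<close> with \<open>lam z > 0\<close>; there \<open>lam\<close> is positive
  on a whole neighbourhood of \<open>z\<close>, so \<open>ln\<close> is applied to positive numbers for all small radii.\<close>

definition curvature :: "(complex \<Rightarrow> real) \<Rightarrow> complex \<Rightarrow> ereal" where
  "curvature lam z = - gen_lower_laplacian (\<lambda>w. ln (lam w)) z / ereal ((lam z)\<^sup>2)"

definition SK_metric :: "complex set \<Rightarrow> (complex \<Rightarrow> real) \<Rightarrow> bool" where
  "SK_metric G lam \<longleftrightarrow>
     conformal_pseudo_metric G lam \<and> (\<forall>z\<in>G. 0 < lam z \<longrightarrow> curvature lam z \<le> -1)"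

definition maximal_SK_metric :: "complex set \<Rightarrow> (complex \<Rightarrow> real) \<Rightarrow> bool" where
  "maximal_SK_metric G lam \<longleftrightarrow>
     SK_metric G lam \<and> (\<forall>mu. SK_metric G mu \<longrightarrow> (\<forall>z\<in>G. mu z \<le> lam z))"

abbreviation unit_disk :: "complex set" where
  "unit_disk \<equiv> ball 0 1"

definition lambda_disk :: "complex \<Rightarrow> real" where
  "lambda_disk z = 2 / (1 - (cmod z)\<^sup>2)"

end

theory Submission
  imports Defs "HOL-Real_Asymp.Real_Asymp"
begin

text \<open>The proof is Ahlfors' maximum principle argument. For \<open>0 < R < 1\<close> the metric
  \<open>2 R / (R\<^sup>2 - |z|\<^sup>2)\<close> has curvature \<open>-1\<close> on the disk of radius \<open>R\<close> and blows up at its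
  boundary, whereas the density \<open>\<lambda>\<close> of an SK-metric on the unit disk stays bounded there. Hence
  the quotient of \<open>\<lambda>\<close> by this density attains its maximum at an interior point \<open>p\<close>. If
  \<open>\<lambda> p > 0\<close>, then the difference of the logarithms of the two densities is maximal at \<open>p\<close>, so
  its circle means around \<open>p\<close> do not exceed its value at \<open>p\<close>, and the generalized Laplacians
  compare as \<open>\<Delta> ln \<lambda> \<le> \<Delta> ln (2 R / (R\<^sup>2 - |z|\<^sup>2))\<close> at \<open>p\<close>. The curvature assumption bounds
  the left-hand side from below by \<open>(\<lambda> p)\<^sup>2\<close>, and the right-hand side is the square of the
  comparison density. Therefore the quotient is at most \<open>1\<close> at \<open>p\<close>, thus everywhere, and
  \<open>R \<rightarrow> 1\<close> gives the bound by \<open>lambda_disk\<close>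
  (\<open>SK_metric_le_disk_density\<close>, \<open>SK_metric_le_lambda_disk\<close>).

  The only computation is the Laplacian of the comparison density, and it is needed in the
  generalized sense, as a limit of circle means
  (\<open>gen_lower_laplacian_ln_disk_density\<close>). It follows from a second order expansion of the
  logarithm along the circle, whose main part is a trigonometric polynomial that can be
  integrated exactly. For \<open>R = 1\<close> the same computation shows that \<open>lambda_disk\<close> itself is an
  SK-metric; being the largest one, it is the only maximal one.\<close>

definition disk_density :: "real \<Rightarrow> complex \<Rightarrow> real" where
  "disk_density R z = 2 * R / (R\<^sup>2 - (cmod z)\<^sup>2)"

lemma lambda_disk_eq_disk_density: "lambda_disk = disk_density 1"
  by (simp add: fun_eq_iff lambda_disk_def disk_density_def)

lemma disk_denominator_pos:
  assumes "z \<in> ball (0::complex) R"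
  shows "R\<^sup>2 - (cmod z)\<^sup>2 > 0"
  using assms power_strict_mono[of "cmod z" R 2] by (simp add: dist_norm)

lemma disk_density_pos:
  assumes "z \<in> ball 0 R"
  shows "disk_density R z > 0"
proof -
  have "R > 0"
    using assms norm_ge_zero[of z] by (simp add: dist_norm del: norm_ge_zero)
  then show ?thesis
    unfolding disk_density_def using disk_denominator_pos[OF assms] by simp
qed

lemma continuous_on_disk_density: "continuous_on (ball 0 R) (disk_density R)"
proof -
  have "R\<^sup>2 - (cmod z)\<^sup>2 \<noteq> 0" if "z \<in> ball 0 R" for z
    using disk_denominator_pos[OF that] by simp
  then show ?thesis
    unfolding disk_density_def[abs_def] by (intro continuous_intros) blast
qed

text \<open>Comparing circle means requires integrability along the circle; continuity on a ball gives it
  for all radii smaller than that of the ball.\<close>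

lemma continuous_on_circle:
  fixes u :: "complex \<Rightarrow> real"
  assumes "continuous_on (ball z e) u" and "0 < r" "r < e"
  shows "continuous_on T (\<lambda>t. u (z + complex_of_real r * exp (\<i> * complex_of_real t)))"
  using assms(2,3)
  by (intro continuous_on_compose2[OF assms(1)] continuous_intros)
     (auto simp: dist_norm norm_mult)

lemma ln_quadratic_error:
  fixes e :: real
  assumes "e > 0"
  shows "\<exists>d>0. \<forall>x. \<bar>x\<bar> < d \<longrightarrow> \<bar>ln (1 + x) - x + x\<^sup>2 / 2\<bar> \<le> e * x\<^sup>2"
proof -
  have "((\<lambda>x::real. (ln (1 + x) - x + x\<^sup>2 / 2) / x\<^sup>2) \<longlongrightarrow> 0) (at 0)"
    by real_asymp
  from tendstoD[OF this assms] obtain d where d: "d > 0"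
    "\<And>x. x \<noteq> 0 \<Longrightarrow> \<bar>x\<bar> < d \<Longrightarrow> \<bar>(ln (1 + x) - x + x\<^sup>2 / 2) / x\<^sup>2\<bar> < e"
    unfolding eventually_at by (auto simp: dist_real_def)
  have "\<bar>ln (1 + x) - x + x\<^sup>2 / 2\<bar> \<le> e * x\<^sup>2" if "\<bar>x\<bar> < d" for x
  proof (cases "x = 0")
    case False
    with d(2)[OF False that] show ?thesis
      by (simp add: divide_less_eq)
  qed simp
  with d(1) show ?thesis by blast
qed

text \<open>By orthogonality, \<open>a * cos t + b * sin t\<close> has mean zero over a period and its square has mean
  \<open>(a\<^sup>2 + b\<^sup>2) / 2\<close>.\<close>

lemma has_integral_trig_quadratic:
  fixes a b c r :: real
  defines "x \<equiv> \<lambda>t. c * (r\<^sup>2 + 2 * r * (a * cos t + b * sin t))"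
  shows "((\<lambda>t. x t - (x t)\<^sup>2 / 2) has_integral
    2 * pi * (c * r\<^sup>2 - c\<^sup>2 * (r ^ 4 / 2 + r\<^sup>2 * (a\<^sup>2 + b\<^sup>2)))) {0..2 * pi}"
proof -
  define P where "P t = a * sin t - b * cos t" for t
  define Q where "Q t = a\<^sup>2 / 2 * (t + sin t * cos t) + b\<^sup>2 / 2 * (t - sin t * cos t)
    + a * b * (sin t)\<^sup>2" for t
  define F where "F t = c * (r\<^sup>2 * t + 2 * r * P t)
    - c\<^sup>2 / 2 * (r ^ 4 * t + 4 * r ^ 3 * P t + 4 * r\<^sup>2 * Q t)" for t
  have P: "(P has_real_derivative a * cos t + b * sin t) (at t within S)" for t S
    unfolding P_def by (auto intro!: derivative_eq_intros)
  have Q: "(Q has_real_derivative (a * cos t + b * sin t)\<^sup>2) (at t within S)" for t S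
  proof -
    have "((\<lambda>t. p * (t + sin t * cos t) + q * (t - sin t * cos t) + s * (sin t)\<^sup>2)
      has_real_derivative p * (1 + (cos t * cos t - sin t * sin t))
      + q * (1 - (cos t * cos t - sin t * sin t)) + s * (2 * sin t * cos t)) (at t within S)"
      for p q s :: real
      by (auto intro!: derivative_eq_intros simp: algebra_simps)
    from this[of "a\<^sup>2 / 2" "b\<^sup>2 / 2" "a * b"]
    have "(Q has_real_derivative a\<^sup>2 / 2 * (1 + (cos t * cos t - sin t * sin t))
      + b\<^sup>2 / 2 * (1 - (cos t * cos t - sin t * sin t))
      + a * b * (2 * sin t * cos t)) (at t within S)"
      unfolding Q_def .
    moreover have double_angle: "1 + (cos t * cos t - sin t * sin t) = 2 * (cos t)\<^sup>2"
      "1 - (cos t * cos t - sin t * sin t) = 2 * (sin t)\<^sup>2"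
      using sin_cos_squared_add[of t] by (simp_all add: power2_eq_square)
    have "a\<^sup>2 / 2 * (1 + (cos t * cos t - sin t * sin t))
      + b\<^sup>2 / 2 * (1 - (cos t * cos t - sin t * sin t)) + a * b * (2 * sin t * cos t)
      = (a * cos t + b * sin t)\<^sup>2"
      unfolding double_angle by (simp add: power2_eq_square algebra_simps)
    ultimately show ?thesis by simp
  qed
  have "(F has_real_derivative x t - (x t)\<^sup>2 / 2) (at t within S)" for t S
  proof -
    have "(F has_real_derivative c * (r\<^sup>2 * 1 + 2 * r * (a * cos t + b * sin t))
      - c\<^sup>2 / 2 * (r ^ 4 * 1 + 4 * r ^ 3 * (a * cos t + b * sin t)
        + 4 * r\<^sup>2 * (a * cos t + b * sin t)\<^sup>2)) (at t within S)"
      unfolding F_def by (intro DERIV_add DERIV_diff DERIV_cmult P Q DERIV_ident)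
    moreover have "c * (r\<^sup>2 * 1 + 2 * r * l) - c\<^sup>2 / 2 * (r ^ 4 * 1 + 4 * r ^ 3 * l + 4 * r\<^sup>2 * l\<^sup>2)
      = c * (r\<^sup>2 + 2 * r * l) - (c * (r\<^sup>2 + 2 * r * l))\<^sup>2 / 2" for l
      by (simp add: field_simps power2_eq_square power3_eq_cube power4_eq_xxxx)
    ultimately show ?thesis unfolding x_def by simp
  qed
  then have "((\<lambda>t. x t - (x t)\<^sup>2 / 2) has_integral F (2 * pi) - F 0) {0..2 * pi}"
    by (intro fundamental_theorem_of_calculus)
       (auto simp: has_real_derivative_iff_has_vector_derivative)
  moreover have "F (2 * pi) - F 0 = 2 * pi * (c * r\<^sup>2 - c\<^sup>2 * (r ^ 4 / 2 + r\<^sup>2 * (a\<^sup>2 + b\<^sup>2)))"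
    unfolding F_def P_def Q_def by (simp add: field_simps)
  ultimately show ?thesis by simp
qed

text \<open>On the circle of radius \<open>r\<close> around \<open>z\<close> the denominator of the density is \<open>D (1 + x t)\<close>
  with \<open>D = R\<^sup>2 - |z|\<^sup>2\<close> and \<open>x t = O(r)\<close>. The quadratic part of \<open>ln (1 + x t)\<close> has mean
  \<open>- r\<^sup>2 (D + |z|\<^sup>2) / D\<^sup>2 = - r\<^sup>2 R\<^sup>2 / D\<^sup>2\<close> up to \<open>O(r ^ 4)\<close>, and the remainder
  is \<open>o(r\<^sup>2)\<close> uniformly in \<open>t\<close>. Multiplication by \<open>- 4 / r\<^sup>2\<close> leaves
  \<open>4 R\<^sup>2 / D\<^sup>2\<close>, which is the square of the density.\<close>

lemma tendsto_laplacian_ln_disk_density: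
  assumes z: "z \<in> ball 0 R"
  shows "((\<lambda>r. 4 / r\<^sup>2 * (1 / (2 * pi) * integral {0..2 * pi}
      (\<lambda>t. ln (disk_density R (z + complex_of_real r * exp (\<i> * complex_of_real t))))
      - ln (disk_density R z))) \<longlongrightarrow> (disk_density R z)\<^sup>2) (at_right 0)"
    (is "(?L \<longlongrightarrow> _) _")
proof (rule tendstoI)
  fix e :: real assume e: "e > 0"
  define a b D where "a = Re z" and "b = Im z" and "D = R\<^sup>2 - (cmod z)\<^sup>2"
  have D: "D > 0"
    using disk_denominator_pos[OF z] by (simp add: D_def)
  have ab: "a\<^sup>2 + b\<^sup>2 = R\<^sup>2 - D"
    by (simp add: a_def b_def D_def cmod_power2)
  define x where "x r t = (- 1 / D) * (r\<^sup>2 + 2 * r * (a * cos t + b * sin t))" for r t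
  define C where "C = (1 + 2 * (\<bar>a\<bar> + \<bar>b\<bar>)) / D"
  have C: "C > 0"
    unfolding C_def using D by (intro divide_pos_pos) auto
  have x_bound: "\<bar>x r t\<bar> \<le> C * r" if "0 < r" "r < 1" for r t
  proof -
    have "\<bar>a * cos t\<bar> \<le> \<bar>a\<bar>" "\<bar>b * sin t\<bar> \<le> \<bar>b\<bar>"
      by (simp_all add: abs_mult mult_left_le)
    then have "\<bar>a * cos t + b * sin t\<bar> \<le> \<bar>a\<bar> + \<bar>b\<bar>" by linarith
    moreover have "\<bar>r + 2 * s\<bar> \<le> 1 + 2 * m" if "\<bar>s\<bar> \<le> m" for s m :: real
      using that \<open>0 < r\<close> \<open>r < 1\<close> by linarith
    ultimately have "\<bar>r + 2 * (a * cos t + b * sin t)\<bar> \<le> 1 + 2 * (\<bar>a\<bar> + \<bar>b\<bar>)" by blast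
    then have "\<bar>r + 2 * (a * cos t + b * sin t)\<bar> / D * r \<le> C * r"
      unfolding C_def using D that by (intro mult_right_mono divide_right_mono) auto
    moreover have "x r t = - ((r + 2 * (a * cos t + b * sin t)) / D * r)"
      unfolding x_def using D by (simp add: field_simps power2_eq_square)
    ultimately show ?thesis
      using D that by (simp add: abs_mult)
  qed
  have point: "R\<^sup>2 - (cmod (z + complex_of_real r * exp (\<i> * complex_of_real t)))\<^sup>2 = D * (1 + x r t)"
    for r t
  proof -
    have "(cmod (z + complex_of_real r * exp (\<i> * complex_of_real t)))\<^sup>2
      = (a + r * cos t)\<^sup>2 + (b + r * sin t)\<^sup>2"
      by (simp add: cmod_power2 a_def b_def Re_exp Im_exp)
    also have "(a + r * p)\<^sup>2 + (b + r * q)\<^sup>2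
      = a\<^sup>2 + b\<^sup>2 + r\<^sup>2 * (q\<^sup>2 + p\<^sup>2) + 2 * r * (a * p + b * q)" for p q
      by (simp add: power2_eq_square algebra_simps)
    finally have "R\<^sup>2 - (cmod (z + complex_of_real r * exp (\<i> * complex_of_real t)))\<^sup>2
      = D - (r\<^sup>2 + 2 * r * (a * cos t + b * sin t))"
      unfolding ab by simp
    moreover have "D * (1 + (- 1 / D) * m) = D - m" for m
      using D by (simp add: field_simps)
    ultimately show ?thesis unfolding x_def by simp
  qed
  \<comment> \<open>The error of the circle mean has two parts, and each is kept below \<open>e / 2\<close>: by the choice of
    \<open>\<epsilon>\<close>, the logarithmic remainder contributes at most \<open>4 / r\<^sup>2 * \<epsilon> * (C * r)\<^sup>2 = e / 2\<close>;
    the term \<open>2 * r\<^sup>2 / D\<^sup>2\<close>, which stems from the square of \<open>r\<^sup>2 / D\<close>, is small by the last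
    entry of \<open>r0\<close>. The entries \<open>d / C\<close> and \<open>1 / C\<close> keep \<open>x r t\<close> where the expansion applies.\<close>
  define \<epsilon> where "\<epsilon> = e / (8 * C\<^sup>2)"
  have "\<epsilon> > 0" using e C by (simp add: \<epsilon>_def)
  then obtain d where d: "d > 0"
    "\<And>y. \<bar>y\<bar> < d \<Longrightarrow> \<bar>ln (1 + y) - y + y\<^sup>2 / 2\<bar> \<le> \<epsilon> * y\<^sup>2"
    using ln_quadratic_error by blast
  define r0 where "r0 = Min {1, d / C, 1 / C, D * sqrt e / 2}"
  have "r0 > 0"
    unfolding r0_def using d(1) C D e by simp
  then have r0: "r0 > 0" "r0 \<le> 1" "r0 \<le> d / C" "r0 \<le> 1 / C" "r0 \<le> D * sqrt e / 2"
    unfolding r0_def by (blast intro: Min_le)+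
  have "dist (?L r) ((disk_density R z)\<^sup>2) < e" if r: "0 < r" "r < r0" for r
  proof -
    have r1: "r < 1" using r r0 by simp
    have "C * r < d" "C * r < 1"
      using less_le_trans[OF r(2) r0(3)] less_le_trans[OF r(2) r0(4)] C
      by (simp_all add: pos_less_divide_eq mult.commute)
    then have small: "\<bar>x r t\<bar> < d" "\<bar>x r t\<bar> < 1" for t
      using x_bound[OF r(1) r1, of t] by auto
    define h where "h t = ln (1 + x r t) - x r t + (x r t)\<^sup>2 / 2" for t
    have pos: "1 + x r t > 0" for t using small(2)[of t] by linarith
    have cont_x: "continuous_on {0..2 * pi} (x r)"
      unfolding x_def by (intro continuous_intros)
    have cont_h: "continuous_on {0..2 * pi} h"
      unfolding h_def using pos by (intro continuous_intros cont_x) (auto simp: less_imp_neq[symmetric])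
    have h_bound: "\<bar>h t\<bar> \<le> \<epsilon> * (C * r)\<^sup>2" for t
    proof -
      have "\<bar>h t\<bar> \<le> \<epsilon> * (x r t)\<^sup>2"
        unfolding h_def using d(2) small(1) by blast
      also have "\<dots> \<le> \<epsilon> * (C * r)\<^sup>2"
        using x_bound[OF r(1) r1, of t] \<open>\<epsilon> > 0\<close>
        by (intro mult_left_mono) (auto simp: abs_le_square_iff[symmetric])
      finally show ?thesis .
    qed
    have "norm (integral {0..2 * pi} h) \<le> \<epsilon> * (C * r)\<^sup>2 * (2 * pi - 0)"
      by (rule integral_bound[OF _ cont_h]) (use h_bound in auto)
    then have H: "\<bar>integral {0..2 * pi} h\<bar> \<le> e * r\<^sup>2 / 8 * (2 * pi)"
      using C by (simp add: \<epsilon>_def power_mult_distrib field_simps)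
    define q where "q = (- 1 / D) * r\<^sup>2 - (- 1 / D)\<^sup>2 * (r ^ 4 / 2 + r\<^sup>2 * (a\<^sup>2 + b\<^sup>2))"
    have q: "q = - r\<^sup>2 * (R\<^sup>2 / D\<^sup>2) - r ^ 4 / (2 * D\<^sup>2)"
      unfolding q_def ab using D by (simp add: field_simps power2_eq_square)
    have "(h has_integral integral {0..2 * pi} h) {0..2 * pi}"
      by (intro integrable_integral integrable_continuous_interval cont_h)
    from has_integral_add[OF has_integral_trig_quadratic[of "- 1 / D" r a b] this]
    have "((\<lambda>t. ln (1 + x r t)) has_integral 2 * pi * q + integral {0..2 * pi} h) {0..2 * pi}"
      by (simp add: h_def x_def q_def)
    from has_integral_diff[OF has_integral_const_real[of "ln (disk_density R z)"] this]
    have "((\<lambda>t. ln (disk_density R z) - ln (1 + x r t)) has_integral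
      2 * pi * ln (disk_density R z) - (2 * pi * q + integral {0..2 * pi} h)) {0..2 * pi}"
      by simp
    moreover have "ln (disk_density R z) - ln (1 + x r t)
      = ln (disk_density R (z + complex_of_real r * exp (\<i> * complex_of_real t)))" for t
    proof -
      have "disk_density R (z + complex_of_real r * exp (\<i> * complex_of_real t))
        = disk_density R z / (1 + x r t)"
        unfolding disk_density_def point by (simp add: D_def)
      then show ?thesis
        using disk_density_pos[OF z] pos[of t] by (simp add: ln_div)
    qed
    ultimately have "integral {0..2 * pi}
      (\<lambda>t. ln (disk_density R (z + complex_of_real r * exp (\<i> * complex_of_real t))))
      = 2 * pi * ln (disk_density R z) - (2 * pi * q + integral {0..2 * pi} h)"
      by (simp add: integral_unique)
    then have "?L r = 4 / r\<^sup>2 * (- q - integral {0..2 * pi} h / (2 * pi))"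
      by (simp add: field_simps)
    also have "\<dots> = (disk_density R z)\<^sup>2 + 2 * r\<^sup>2 / D\<^sup>2
        - 4 / r\<^sup>2 * (integral {0..2 * pi} h / (2 * pi))"
      unfolding q disk_density_def D_def[symmetric] using r D
      by (simp add: field_simps power2_eq_square power4_eq_xxxx)
    finally have L: "?L r - (disk_density R z)\<^sup>2
      = 2 * r\<^sup>2 / D\<^sup>2 - 4 / r\<^sup>2 * (integral {0..2 * pi} h / (2 * pi))" by simp
    have "\<bar>integral {0..2 * pi} h / (2 * pi)\<bar> \<le> e * r\<^sup>2 / 8"
      using H by (simp add: abs_mult pos_divide_le_eq mult_ac)
    then have "4 / r\<^sup>2 * \<bar>integral {0..2 * pi} h / (2 * pi)\<bar> \<le> 4 / r\<^sup>2 * (e * r\<^sup>2 / 8)"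
      by (intro mult_left_mono) auto
    then have "\<bar>4 / r\<^sup>2 * (integral {0..2 * pi} h / (2 * pi))\<bar> \<le> e / 2"
      using r by (simp add: abs_mult)
    moreover have "2 * r\<^sup>2 / D\<^sup>2 < e / 2"
    proof -
      have "r\<^sup>2 < (D * sqrt e / 2)\<^sup>2"
        using r r0 by (intro power_strict_mono) auto
      then have "r\<^sup>2 < D\<^sup>2 * e / 4"
        using e by (simp add: power_mult_distrib power_divide)
      then show ?thesis using D by (simp add: field_simps)
    qed
    moreover have "0 \<le> 2 * r\<^sup>2 / D\<^sup>2" by simp
    moreover have "\<bar>y - w\<bar> < e" if "\<bar>w\<bar> \<le> e / 2" "y < e / 2" "0 \<le> y" for y w
      using that by linarith
    ultimately show ?thesis
      unfolding dist_real_def L by blast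
  qed
  then show "\<forall>\<^sub>F r in at_right 0. dist (?L r) ((disk_density R z)\<^sup>2) < e"
    unfolding eventually_at_right_field using r0(1) by blast
qed

lemma gen_lower_laplacian_ln_disk_density:
  assumes "z \<in> ball 0 R"
  shows "gen_lower_laplacian (\<lambda>w. ln (disk_density R w)) z = ereal ((disk_density R z)\<^sup>2)"
  unfolding gen_lower_laplacian_def
  by (intro lim_imp_Liminf tendsto_ereal tendsto_laplacian_ln_disk_density[OF assms]) simp

lemma SK_metric_lambda_disk: "SK_metric unit_disk lambda_disk"
  unfolding SK_metric_def conformal_pseudo_metric_def lambda_disk_eq_disk_density
proof (intro conjI ballI impI)
  fix z :: complex assume z: "z \<in> unit_disk"
  show "0 \<le> disk_density 1 z" using disk_density_pos[OF z] by simp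
  show "curvature (disk_density 1) z \<le> - 1"
    unfolding curvature_def gen_lower_laplacian_ln_disk_density[OF z]
    using disk_density_pos[OF z] by (simp add: one_ereal_def)
next
  show "\<exists>z\<in>unit_disk. disk_density 1 z \<noteq> 0"
    by (rule bexI[of _ 0]) (simp_all add: disk_density_def)
qed (simp_all add: continuous_on_disk_density)

text \<open>At a maximum of \<open>u - v\<close> every small circle mean of \<open>u - v\<close> is at most its value at the
  centre, so the difference quotients already compare before the lower limit is taken. This
  replaces the second derivative test.\<close>

lemma gen_lower_laplacian_mono_at_max:
  assumes "e > 0" and u: "continuous_on (ball z e) u" and v: "continuous_on (ball z e) v"
    and max: "\<And>w. w \<in> ball z e \<Longrightarrow> u w - v w \<le> u z - v z"
  shows "gen_lower_laplacian u z \<le> gen_lower_laplacian v z"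
  unfolding gen_lower_laplacian_def
proof (rule Liminf_mono)
  define c where "c r t = z + complex_of_real r * exp (\<i> * complex_of_real t)" for r t
  have "1 / (2 * pi) * integral {0..2 * pi} (\<lambda>t. u (c r t)) - u z
      \<le> 1 / (2 * pi) * integral {0..2 * pi} (\<lambda>t. v (c r t)) - v z"
    if r: "0 < r" "r < e" for r
  proof -
    have int: "(\<lambda>t. u (c r t)) integrable_on {0..2 * pi}"
      "(\<lambda>t. v (c r t)) integrable_on {0..2 * pi}"
      unfolding c_def
      by (intro integrable_continuous_interval continuous_on_circle[OF _ r] u v)+
    have "integral {0..2 * pi} (\<lambda>t. u (c r t)) - integral {0..2 * pi} (\<lambda>t. v (c r t))
      = integral {0..2 * pi} (\<lambda>t. u (c r t) - v (c r t))"
      using int by (simp add: integral_diff)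
    also have "\<dots> \<le> integral {0..2 * pi} (\<lambda>t. u z - v z)"
      using r by (intro integral_le integrable_diff int max) (auto simp: c_def dist_norm norm_mult)
    also have "\<dots> = 2 * pi * (u z - v z)" by simp
    finally have "(integral {0..2 * pi} (\<lambda>t. u (c r t)) - integral {0..2 * pi} (\<lambda>t. v (c r t)))
      / (2 * pi) \<le> u z - v z"
      by (simp add: pos_divide_le_eq mult.commute)
    then show ?thesis by (simp add: diff_divide_distrib)
  qed
  then have "ereal (4 / r\<^sup>2 * (1 / (2 * pi) * integral {0..2 * pi} (\<lambda>t. u (c r t)) - u z))
      \<le> ereal (4 / r\<^sup>2 * (1 / (2 * pi) * integral {0..2 * pi} (\<lambda>t. v (c r t)) - v z))"
    if "0 < r" "r < e" for r
    unfolding ereal_less_eq using that by (intro mult_left_mono) auto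
  then show "\<forall>\<^sub>F r in at_right 0.
      ereal (4 / r\<^sup>2 * (1 / (2 * pi) * integral {0..2 * pi}
        (\<lambda>t. u (z + complex_of_real r * exp (\<i> * complex_of_real t))) - u z))
      \<le> ereal (4 / r\<^sup>2 * (1 / (2 * pi) * integral {0..2 * pi}
        (\<lambda>t. v (z + complex_of_real r * exp (\<i> * complex_of_real t))) - v z))"
    unfolding eventually_at_right_field c_def using \<open>e > 0\<close> by blast
qed

lemma gen_lower_laplacian_ge_if_curvature_le:
  assumes "curvature lam z \<le> - 1" and "lam z > 0"
  shows "ereal ((lam z)\<^sup>2) \<le> gen_lower_laplacian (\<lambda>w. ln (lam w)) z"
  using assms unfolding curvature_def
  by (cases "gen_lower_laplacian (\<lambda>w. ln (lam w)) z")
     (auto simp: one_ereal_def field_simps)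

text \<open>Multiplying \<open>lam\<close> by \<open>R\<^sup>2 - |z|\<^sup>2\<close> instead of dividing it by the comparison density gives a
  function that is continuous up to the boundary and vanishes there, so that its maximum over the
  closed disk, if positive, is attained inside.\<close>

lemma SK_metric_le_disk_density:
  assumes SK: "SK_metric unit_disk lam" and R: "0 < R" "R < 1" and z: "z \<in> ball 0 R"
  shows "lam z \<le> disk_density R z"
proof -
  have cont: "continuous_on unit_disk lam"
    and curv: "\<And>w. w \<in> unit_disk \<Longrightarrow> 0 < lam w \<Longrightarrow> curvature lam w \<le> - 1"
    using SK by (auto simp: SK_metric_def conformal_pseudo_metric_def)
  define f where "f w = lam w * (R\<^sup>2 - (cmod w)\<^sup>2)" for w
  have "continuous_on (cball 0 R) f"
    unfolding f_def using R
    by (intro continuous_intros continuous_on_subset[OF cont]) auto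
  then obtain p where p: "p \<in> cball 0 R" and p_max: "\<And>w. w \<in> cball 0 R \<Longrightarrow> f w \<le> f p"
    using continuous_attains_sup[of "cball 0 R" f] R by auto
  have "f p \<le> 2 * R"
  proof (rule ccontr)
    assume "\<not> f p \<le> 2 * R"
    then have fp: "f p > 2 * R" by simp
    then have "f p > 0" using R by simp
    then have "cmod p \<noteq> R" unfolding f_def by auto
    with p have pR: "p \<in> ball 0 R" by (simp add: dist_norm)
    then have p1: "p \<in> unit_disk" using R by simp
    have lam_p: "lam p > 0"
      using \<open>f p > 0\<close> disk_denominator_pos[OF pR] unfolding f_def by (simp add: zero_less_mult_iff)
    have "\<exists>e>0. ball p e \<subseteq> {w \<in> ball 0 R. 0 < lam w}"
    proof -
      have "continuous_on (ball 0 R) lam"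
        using R by (intro continuous_on_subset[OF cont]) auto
      then have "open (ball 0 R \<inter> lam -` {0<..})"
        by (intro continuous_open_preimage) auto
      then show ?thesis
        using pR lam_p by (auto simp: open_contains_ball subset_eq)
    qed
    then obtain e where e: "e > 0" "ball p e \<subseteq> {w \<in> ball 0 R. 0 < lam w}" by blast
    have ratio: "ln (lam w) - ln (disk_density R w) = ln (f w / (2 * R))"
      if "w \<in> ball 0 R" "0 < lam w" for w
    proof -
      have "f w / (2 * R) = lam w / disk_density R w"
        by (simp add: f_def disk_density_def)
      then show ?thesis
        using disk_density_pos[OF that(1)] that(2) by (simp add: ln_div)
    qed
    have "gen_lower_laplacian (\<lambda>w. ln (lam w)) p
      \<le> gen_lower_laplacian (\<lambda>w. ln (disk_density R w)) p"
    proof (rule gen_lower_laplacian_mono_at_max[OF e(1)])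
      have "continuous_on (ball p e) lam" "continuous_on (ball p e) (disk_density R)"
        using e(2) R
        by (auto intro!: continuous_on_subset[OF cont]
            continuous_on_subset[OF continuous_on_disk_density])
      then show "continuous_on (ball p e) (\<lambda>w. ln (lam w))"
        "continuous_on (ball p e) (\<lambda>w. ln (disk_density R w))"
        using e(2) disk_density_pos
        by (auto intro!: continuous_on_ln simp: subset_eq less_imp_neq[symmetric])
    next
      fix w assume "w \<in> ball p e"
      with e(2) have w: "w \<in> ball 0 R" "0 < lam w" by auto
      then have "0 < f w"
        unfolding f_def using disk_denominator_pos by simp
      moreover have "f w \<le> f p" using p_max w(1) by simp
      ultimately show "ln (lam w) - ln (disk_density R w) \<le> ln (lam p) - ln (disk_density R p)"
        unfolding ratio[OF w] ratio[OF pR lam_p] using R by (simp add: divide_right_mono)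
    qed
    also have "\<dots> = ereal ((disk_density R p)\<^sup>2)"
      by (rule gen_lower_laplacian_ln_disk_density[OF pR])
    finally have "(lam p)\<^sup>2 \<le> (disk_density R p)\<^sup>2"
      using gen_lower_laplacian_ge_if_curvature_le[of lam p, OF curv[OF p1 lam_p] lam_p]
      by (metis order_trans ereal_less_eq(3))
    then have "lam p \<le> disk_density R p"
      using disk_density_pos[OF pR] by (rule power2_le_imp_le[OF _ less_imp_le])
    then have "f p \<le> 2 * R"
      unfolding f_def disk_density_def using disk_denominator_pos[OF pR] by (simp add: pos_le_divide_eq)
    with fp show False by simp
  qed
  moreover have "f z \<le> f p" using p_max z by simp
  ultimately have "f z \<le> 2 * R" by simp
  then show ?thesis
    unfolding f_def disk_density_def using disk_denominator_pos[OF z] by (simp add: pos_le_divide_eq)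
qed

lemma SK_metric_le_lambda_disk:
  assumes SK: "SK_metric unit_disk lam" and z: "z \<in> unit_disk"
  shows "lam z \<le> lambda_disk z"
proof -
  have "((\<lambda>R. disk_density R z) \<longlongrightarrow> disk_density 1 z) (at_left 1)"
    unfolding disk_density_def using disk_denominator_pos[OF z]
    by (intro tendsto_intros) auto
  moreover have "lam z \<le> disk_density R z" if "cmod z < R" "R < 1" for R
    using that by (intro SK_metric_le_disk_density[OF SK]) (auto intro: le_less_trans[OF norm_ge_zero])
  then have "\<forall>\<^sub>F R in at_left 1. lam z \<le> disk_density R z"
    unfolding eventually_at_left_field using z by auto
  ultimately have "lam z \<le> disk_density 1 z"
    by (intro tendsto_lowerbound[of _ _ "at_left (1::real)"]) auto
  then show ?thesis by (simp add: lambda_disk_eq_disk_density)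
qed

theorem theorem4p4:
  "(\<forall>lam. SK_metric unit_disk lam \<longrightarrow> (\<forall>z\<in>unit_disk. lam z \<le> lambda_disk z)) \<and>
   maximal_SK_metric unit_disk lambda_disk \<and>
   (\<forall>mu. maximal_SK_metric unit_disk mu \<longrightarrow> (\<forall>z\<in>unit_disk. mu z = lambda_disk z))"
  using SK_metric_le_lambda_disk SK_metric_lambda_disk
  unfolding maximal_SK_metric_def by (blast intro: order_antisym)

end
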